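(* Let $k\in\mathbb N$, $m_1,\dots,m_k\in\mathbb N$ and $b_1,\dots,b_k\in\mathbb R\setminus\{0\}$. Then for all $n\in\mathbb N$, $$S_{m_1,m_2,\ldots,m_k}(b_1,b_2,\ldots,b_k;n)=I_{m_1,m_2,\ldots,m_k}(b_1,b_2,\ldots,b_k;n),$$ where $S$ denotes the generalized harmonic sum and $I$ the nested integral defined in the context.
   Context: $\mathbb N=\{1,2,\dots\}$. The generalized harmonic sum ($S$-sum) is $$S_{m_1,\ldots,m_k}(b_1,\ldots,b_k;n)=\sum_{i_1=1}^n\frac{b_1^{i_1}}{i_1^{m_1}}\sum_{i_2=1}^{i_1}\frac{b_2^{i_2}}{i_2^{m_2}}\cdots\sum_{i_k=1}^{i_{k-1}}\frac{b_k^{i_k}}{i_k^{m_k}}.$$ The nested integral $I_{m_1,\ldots,m_k}(b_1,\ldots,b_k;z)$ is the following iterated integral, described from the inside out. Put $B_0=1$ and $B_j=b_1b_2\cdots b_j$ for $1\le j\le k$, and let $F_0(x)=x^z-1$. For $j=1,\dots,k$ define $$g_{j,1}(u)=\frac{F_{j-1}(u)}{u-B_{j-1}},\qquad g_{j,i}(u)=\frac1u\int_0^u g_{j,i-1}(t)\,dt\quad(2\le i\le m_j),$$ $$F_j(x)=\int_{B_j}^{x}g_{j,m_j}(u)\,du .$$ Finally $$I_{m_1,\ldots,m_k}(b_1,\ldots,b_k;z)=\int_0^{b_1\cdots b_k}g_{k,m_k}(u)\,du.$$ Thus within block $j<k$ the outermost integration runs from $b_1\cdots b_j$ to the innermost variable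 of block $j+1$, all other integrations start at $0$, the innermost denominator of block $j\ge 2$ is $x-b_1\cdots b_{j-1}$, the innermost integrand of block $1$ is $\frac{x^z-1}{x-1}$, and all other integrands carry the factor $1/x$. (Singularities at zeros of denominators are removable.) Example: $I_{2,1}(a,b;n)=\int_0^{ab}\frac{1}{x-a}\int_a^x\frac1y\int_0^y\frac{z^n-1}{z-1}\,dz\,dy\,dx$. *)

theory Defs
  imports "HOL-Analysis.Analysis"
begin

text \<open>
  The families \<open>m\<^sub>1, \<dots>, m\<^sub>k\<close> and \<open>b\<^sub>1, \<dots>, b\<^sub>k\<close> are functions on \<^typ>\<open>nat\<close>, of which only the
  values at \<open>1, \<dots>, k\<close> are used.
\<close>

text \<open>
  \<open>S_from m b r j n\<close> consists of the \<open>r\<close> nested sums with the indices \<open>j, \<dots>, j + r - 1\<close>, where \<open>n\<close>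
  is the upper limit of the outermost one (the sum over \<open>i\<^sub>j\<close>).
\<close>

primrec S_from :: "(nat \<Rightarrow> nat) \<Rightarrow> (nat \<Rightarrow> real) \<Rightarrow> nat \<Rightarrow> nat \<Rightarrow> nat \<Rightarrow> real" where
  "S_from m b 0 j n = 1"
| "S_from m b (Suc r) j n = (\<Sum>i=1..n. b j ^ i / real i ^ m j * S_from m b r (Suc j) i)"

definition S_sum :: "nat \<Rightarrow> (nat \<Rightarrow> nat) \<Rightarrow> (nat \<Rightarrow> real) \<Rightarrow> nat \<Rightarrow> real" where
  "S_sum k m b n = S_from m b k 1 n"

text \<open>
  The interval integral \<open>LBINT u=p..q. f u\<close> is oriented (it changes sign if \<open>p\<close> and \<open>q\<close> are swapped),
  as needed here since the \<open>b\<^sub>i\<close> may be negative.  The removable singularities of the integrands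
  need no special treatment: division by zero yields \<open>0\<close>, which alters an integrand in at most
  one point for each denominator and hence does not affect any of the integrals.
\<close>

definition B_prod :: "(nat \<Rightarrow> real) \<Rightarrow> nat \<Rightarrow> real" where
  "B_prod b j = (\<Prod>i=1..j. b i)"

definition int_div :: "(real \<Rightarrow> real) \<Rightarrow> real \<Rightarrow> real" where
  "int_div f u = 1 / u * (LBINT t=0..u. f t)"

text \<open>
  \<open>g_fun b F j i\<close> is \<open>g\<^bsub>j,i\<^esub>\<close> for \<open>j, i \<ge> 1\<close>, where \<open>F\<close> is the function \<open>F\<^bsub>j-1\<^esub>\<close> of the preceding block.
\<close>

definition g_fun :: "(nat \<Rightarrow> real) \<Rightarrow> (real \<Rightarrow> real) \<Rightarrow> nat \<Rightarrow> nat \<Rightarrow> real \<Rightarrow> real" where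
  "g_fun b F j i = (int_div ^^ (i - 1)) (\<lambda>u. F u / (u - B_prod b (j - 1)))"

text \<open>
  The parameter \<open>z\<close> is a natural number, so that \<open>x ^ z\<close> makes sense for negative \<open>x\<close> as well.
\<close>

primrec F_fun :: "(nat \<Rightarrow> nat) \<Rightarrow> (nat \<Rightarrow> real) \<Rightarrow> nat \<Rightarrow> nat \<Rightarrow> real \<Rightarrow> real" where
  "F_fun m b z 0 = (\<lambda>x. x ^ z - 1)"
| "F_fun m b z (Suc j) =
     (\<lambda>x. LBINT u=B_prod b (Suc j)..x. g_fun b (F_fun m b z j) (Suc j) (m (Suc j)) u)"

definition I_int :: "nat \<Rightarrow> (nat \<Rightarrow> nat) \<Rightarrow> (nat \<Rightarrow> real) \<Rightarrow> nat \<Rightarrow> real" where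
  "I_int k m b z = (LBINT u=0..B_prod b k. g_fun b (F_fun m b z (k - 1)) k (m k) u)"

end

theory Submission
  imports Defs
begin

text \<open>
  \<open>F\<^sub>j(x)\<close> is a polynomial \<open>\<Sum>l=1..n. c\<^sub>j(l) (x^l - B\<^sub>j^l)\<close>. Except at finitely many points, which
  the integrals ignore, dividing by \<open>x - B\<^sub>j\<close> turns \<open>x^l - B\<^sub>j^l\<close> into a geometric sum, and each of the
  \<open>m\<^bsub>j+1\<^esub>\<close> integrations divides the coefficient of \<open>x^(p-1)\<close> by \<open>p\<close>. Hence
  \<open>c\<^bsub>j+1\<^esub>(p) = (\<Sum>l=p..n. c\<^sub>j(l) B\<^sub>j^(l-p)) / p^m\<^bsub>j+1\<^esub>\<close>, and exchanging the order of summation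
  shows that \<open>\<Sum>l=1..n. c\<^sub>j(l) B\<^sub>j^l S_from m b (k-j) (j+1) l\<close> does not depend on \<open>j\<close>. It is the
  \<open>S\<close>-sum for \<open>j = 0\<close> and the nested integral for \<open>j = k\<close>.
\<close>

primrec F_coeff :: "(nat \<Rightarrow> nat) \<Rightarrow> (nat \<Rightarrow> real) \<Rightarrow> nat \<Rightarrow> nat \<Rightarrow> nat \<Rightarrow> real" where
  "F_coeff m b n 0 p = (if p = n then 1 else 0)"
| "F_coeff m b n (Suc j) p =
     (\<Sum>l=p..n. F_coeff m b n j l * B_prod b j ^ (l - p)) / real p ^ m (Suc j)"

text \<open>The finite exceptional set absorbs the points where a denominator vanishes and division
  by zero returns 0. Pairing \<open>a p\<close> with \<open>u ^ (p - 1)\<close> makes integration a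
  mere division by \<open>p\<close>.\<close>

lemma interval_integral_polynomial_except_finite:
  fixes f :: "real \<Rightarrow> real" and a :: "nat \<Rightarrow> real"
  assumes "finite {u. f u \<noteq> (\<Sum>p=1..n. a p * u ^ (p - 1))}"
  shows "(LBINT u=ereal x..ereal y. f u) = (\<Sum>p=1..n. a p / real p * (y ^ p - x ^ p))"
proof -
  let ?P = "\<lambda>u. \<Sum>p=1..n. a p * u ^ (p - 1)"
  let ?Q = "\<lambda>u. \<Sum>p=1..n. a p / real p * u ^ p"
  have "(LBINT u=ereal x..ereal y. f u) = (LBINT u=ereal x..ereal y. ?P u)"
    by (rule interval_integral_discrete_difference[where X = "{u. f u \<noteq> ?P u}"])
       (use assms in \<open>auto simp: countable_finite\<close>)
  also have "\<dots> = ?Q y - ?Q x"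
  proof (rule interval_integral_FTC_finite)
    show "continuous_on {min x y..max x y} ?P"
      by (intro continuous_intros)
    fix u :: real
    have "(?Q has_real_derivative (\<Sum>p=1..n. a p / real p * (real p * u ^ (p - 1))))
        (at u within {min x y..max x y})"
      by (auto intro!: derivative_eq_intros sum.cong)
    also have "(\<Sum>p=1..n. a p / real p * (real p * u ^ (p - 1))) = ?P u"
      by (intro sum.cong) auto
    finally show "(?Q has_vector_derivative ?P u) (at u within {min x y..max x y})"
      by (simp add: has_real_derivative_iff_has_vector_derivative)
  qed
  finally show ?thesis
    by (simp add: sum_subtractf right_diff_distrib)
qed

text \<open>Integrating \<open>u ^ (p - 1)\<close> from 0 and dividing by \<open>u\<close> restores
  the same monomial with factor \<open>1 / p\<close>, so monomials are eigenfunctions of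
  \<open>int_div\<close>.\<close>

lemma int_div_iterate_polynomial:
  assumes "finite {u. f u \<noteq> (\<Sum>p=1..n. a p * u ^ (p - 1))}"
  shows "finite {u. (int_div ^^ i) f u \<noteq> (\<Sum>p=1..n. a p / real p ^ i * u ^ (p - 1))}"
proof (induction i)
  case 0
  show ?case using assms by simp
next
  case (Suc i)
  \<comment> \<open>Exceptions do not accumulate: the integral ignores those of
    \<open>(int_div ^^ i) f\<close>, which leaves only the origin, where \<open>1 / u\<close>
    degenerates.\<close>
  have "(int_div ^^ Suc i) f u = (\<Sum>p=1..n. a p / real p ^ Suc i * u ^ (p - 1))"
    if "u \<noteq> 0" for u
  proof -
    have "(int_div ^^ Suc i) f u = 1 / u * (LBINT t=ereal 0..ereal u. (int_div ^^ i) f t)"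
      by (simp add: int_div_def zero_ereal_def)
    also have "\<dots> = 1 / u * (\<Sum>p=1..n. a p / real p ^ i / real p * (u ^ p - 0 ^ p))"
      by (subst interval_integral_polynomial_except_finite[OF Suc.IH]) simp
    also have "\<dots> = (\<Sum>p=1..n. a p / real p ^ Suc i * u ^ (p - 1))"
      unfolding sum_distrib_left
      by (intro sum.cong) (use that in \<open>auto simp: field_simps power_eq_if\<close>)
    finally show ?thesis .
  qed
  then have "{u. (int_div ^^ Suc i) f u \<noteq> (\<Sum>p=1..n. a p / real p ^ Suc i * u ^ (p - 1))} \<subseteq> {0}"
    by blast
  then show ?case
    by (rule finite_subset) simp
qed

lemma sum_triangle_swap:
  fixes h :: "nat \<Rightarrow> nat \<Rightarrow> 'a::comm_monoid_add"
  shows "(\<Sum>l=1..n. \<Sum>p=1..l. h l p) = (\<Sum>p=1..n. \<Sum>l=p..n. h l p)"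
  unfolding sum.Sigma[OF finite_atLeastAtMost ballI[OF finite_atLeastAtMost]]
  by (rule sum.reindex_bij_witness[of _ "\<lambda>(p, l). (l, p)" "\<lambda>(l, p). (p, l)"]) auto

lemma power_diff_quotient:
  fixes x y :: real
  assumes "x \<noteq> y"
  shows "(x ^ l - y ^ l) / (x - y) = (\<Sum>p=1..l. y ^ (l - p) * x ^ (p - 1))"
proof -
  have "x ^ l - y ^ l = (x - y) * (\<Sum>i<l. y ^ (l - Suc i) * x ^ i)"
    by (rule power_diff_sumr2)
  also have "(\<Sum>i<l. y ^ (l - Suc i) * x ^ i) = (\<Sum>p=1..l. y ^ (l - p) * x ^ (p - 1))"
    by (rule sum.reindex_bij_witness[of _ "\<lambda>p. p - 1" Suc]) auto
  finally show ?thesis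
    using assms by simp
qed

text \<open>Each \<open>u ^ l - B ^ l\<close> over \<open>u - B\<close> is a geometric sum, and
  swapping the double sum collects the coefficient of \<open>u ^ (p - 1)\<close>. The
  \<open>i - 1\<close> applications of \<open>int_div\<close> then contribute
  \<open>real p ^ (i - 1)\<close>.\<close>

lemma g_fun_polynomial:
  assumes "\<And>x. F x = (\<Sum>l=1..n. c l * (x ^ l - B_prod b (j - 1) ^ l))"
  shows "finite {u. g_fun b F j i u \<noteq>
    (\<Sum>p=1..n. (\<Sum>l=p..n. c l * B_prod b (j - 1) ^ (l - p)) / real p ^ (i - 1) * u ^ (p - 1))}"
  unfolding g_fun_def
proof (rule int_div_iterate_polynomial)
  let ?B = "B_prod b (j - 1)"
  have "F u / (u - ?B) = (\<Sum>p=1..n. (\<Sum>l=p..n. c l * ?B ^ (l - p)) * u ^ (p - 1))"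
    if "u \<noteq> ?B" for u
  proof -
    have "F u / (u - ?B) = (\<Sum>l=1..n. c l * ((u ^ l - ?B ^ l) / (u - ?B)))"
      by (simp add: assms sum_divide_distrib)
    also have "\<dots> = (\<Sum>l=1..n. \<Sum>p=1..l. c l * ?B ^ (l - p) * u ^ (p - 1))"
      unfolding power_diff_quotient[OF that] by (simp add: sum_distrib_left mult.assoc)
    also have "\<dots> = (\<Sum>p=1..n. (\<Sum>l=p..n. c l * ?B ^ (l - p)) * u ^ (p - 1))"
      unfolding sum_triangle_swap by (simp add: sum_distrib_right)
    finally show ?thesis .
  qed
  then have "{u. F u / (u - ?B) \<noteq>
      (\<Sum>p=1..n. (\<Sum>l=p..n. c l * ?B ^ (l - p)) * u ^ (p - 1))} \<subseteq> {?B}"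
    by blast
  then show "finite {u. F u / (u - ?B) \<noteq>
      (\<Sum>p=1..n. (\<Sum>l=p..n. c l * ?B ^ (l - p)) * u ^ (p - 1))}"
    by (rule finite_subset) simp
qed

text \<open>The lower limit stays arbitrary because two cases are needed:
  \<open>B_prod b (Suc j)\<close> for the next \<open>F_fun\<close>, and 0 for the outermost
  integral in \<open>I_int\<close>.\<close>

lemma integral_g_fun:
  assumes "\<And>x. F_fun m b n j x = (\<Sum>l=1..n. F_coeff m b n j l * (x ^ l - B_prod b j ^ l))"
    and "m (Suc j) \<ge> 1"
  shows "(LBINT u=ereal x..ereal y. g_fun b (F_fun m b n j) (Suc j) (m (Suc j)) u) =
    (\<Sum>p=1..n. F_coeff m b n (Suc j) p * (y ^ p - x ^ p))"
proof -
  have "finite {u. g_fun b (F_fun m b n j) (Suc j) (m (Suc j)) u \<noteq>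
      (\<Sum>p=1..n. (\<Sum>l=p..n. F_coeff m b n j l * B_prod b j ^ (l - p))
        / real p ^ (m (Suc j) - 1) * u ^ (p - 1))}"
    using g_fun_polynomial[where F = "F_fun m b n j" and c = "F_coeff m b n j" and j = "Suc j"]
      assms(1) by simp
  from interval_integral_polynomial_except_finite[OF this] show ?thesis
    \<comment> \<open>The outer integration supplies the last factor \<open>1 / p\<close>,
      completing \<open>m (Suc j) - 1\<close> to \<open>m (Suc j)\<close>.\<close>
    using assms(2) by (simp add: power_eq_if mult.commute)
qed

lemma F_fun_eq:
  assumes "n \<ge> 1" and "\<And>i. i \<in> {1..j} \<Longrightarrow> m i \<ge> 1"
  shows "F_fun m b n j x = (\<Sum>l=1..n. F_coeff m b n j l * (x ^ l - B_prod b j ^ l))"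
  using assms(2)
proof (induction j arbitrary: x)
  case 0
  have "(\<Sum>l=1..n. F_coeff m b n 0 l * (x ^ l - B_prod b 0 ^ l)) =
      (\<Sum>l=1..n. if l = n then x ^ n - 1 else 0)"
    by (intro sum.cong) (auto simp: B_prod_def)
  then show ?case
    using assms(1) by simp
next
  case (Suc j)
  show ?case
    by (simp only: F_fun.simps, rule integral_g_fun) (use Suc in auto)
qed

text \<open>Peeling off the outermost sum of \<open>S_from\<close> and exchanging summations moves
  one index of the \<open>S\<close>-sum into the coefficients.\<close>

lemma F_coeff_sum_invariant:
  "(\<Sum>l=1..n. F_coeff m b n (Suc j) l * B_prod b (Suc j) ^ l * S_from m b r (Suc (Suc j)) l) =
   (\<Sum>l=1..n. F_coeff m b n j l * B_prod b j ^ l * S_from m b (Suc r) (Suc j) l)"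
proof -
  let ?s = "\<lambda>p. b (Suc j) ^ p / real p ^ m (Suc j) * S_from m b r (Suc (Suc j)) p"
  have "(\<Sum>l=1..n. F_coeff m b n j l * B_prod b j ^ l * S_from m b (Suc r) (Suc j) l) =
      (\<Sum>l=1..n. \<Sum>p=1..l. F_coeff m b n j l * B_prod b j ^ l * ?s p)"
    by (simp add: sum_distrib_left)
  also have "\<dots> = (\<Sum>p=1..n. \<Sum>l=p..n. F_coeff m b n j l * B_prod b j ^ l * ?s p)"
    by (rule sum_triangle_swap)
  \<comment> \<open>Since \<open>p \<le> l\<close>, the power of \<open>B_prod b j\<close> splits at
    \<open>p\<close>; the part with exponent \<open>p\<close> merges with
    \<open>b (Suc j) ^ p\<close> into \<open>B_prod b (Suc j) ^ p\<close>.\<close>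
  also have "\<dots> = (\<Sum>p=1..n. \<Sum>l=p..n.
      F_coeff m b n j l * B_prod b j ^ (l - p) * (B_prod b j ^ p * ?s p))"
    by (intro sum.cong refl) (auto simp flip: power_add)
  also have "\<dots> = (\<Sum>l=1..n. F_coeff m b n (Suc j) l * B_prod b (Suc j) ^ l
      * S_from m b r (Suc (Suc j)) l)"
    by (intro sum.cong refl)
       (simp add: B_prod_def power_mult_distrib sum_distrib_left sum_divide_distrib mult_ac)
  finally show ?thesis by simp
qed

text \<open>At \<open>j = 0\<close> only the term \<open>l = n\<close> survives, with
  \<open>B_prod b 0 = 1\<close>; at \<open>j = k\<close> the factor \<open>S_from\<close> is 1,
  leaving only coefficients and powers.\<close>

lemma S_sum_eq_F_coeff:
  assumes "n \<ge> 1" and "j \<le> k"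
  shows "S_sum k m b n =
    (\<Sum>l=1..n. F_coeff m b n j l * B_prod b j ^ l * S_from m b (k - j) (Suc j) l)"
  using assms(2)
proof (induction j)
  case 0
  have "(\<Sum>l=1..n. F_coeff m b n 0 l * B_prod b 0 ^ l * S_from m b (k - 0) (Suc 0) l) =
      (\<Sum>l=1..n. if l = n then S_from m b k 1 n else 0)"
    by (intro sum.cong) (auto simp: B_prod_def)
  then show ?case
    using assms(1) by (simp add: S_sum_def)
next
  case (Suc j)
  then have "Suc (k - Suc j) = k - j" by simp
  with Suc F_coeff_sum_invariant[of m b n j "k - Suc j"] show ?case
    by (simp del: F_coeff.simps S_from.simps)
qed

theorem theorem2p2:
  fixes k n :: nat and m :: "nat \<Rightarrow> nat" and b :: "nat \<Rightarrow> real"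
  assumes "k \<ge> 1"
    and "\<And>i. i \<in> {1..k} \<Longrightarrow> m i \<ge> 1"
    and "\<And>i. i \<in> {1..k} \<Longrightarrow> b i \<noteq> 0"
    and "n \<ge> 1"
  shows "S_sum k m b n = I_int k m b n"
proof -
  obtain j where k: "k = Suc j"
    using assms(1) by (cases k) auto
  have F: "F_fun m b n j x = (\<Sum>l=1..n. F_coeff m b n j l * (x ^ l - B_prod b j ^ l))" for x
    by (rule F_fun_eq) (use assms(2,4) k in auto)
  have "I_int k m b n = (\<Sum>p=1..n. F_coeff m b n k p * (B_prod b k ^ p - 0 ^ p))"
    using integral_g_fun[of m b n j 0 "B_prod b k", OF F] assms(2) k
    by (simp add: I_int_def zero_ereal_def del: F_coeff.simps)
  \<comment> \<open>The lower limit 0 contributes nothing because every exponent \<open>p\<close> is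
    positive.\<close>
  also have "\<dots> = (\<Sum>p=1..n. F_coeff m b n k p * B_prod b k ^ p)"
    by (intro sum.cong) auto
  also have "\<dots> = S_sum k m b n"
    using S_sum_eq_F_coeff[of n k k m b] assms(4) by simp
  finally show ?thesis by simp
qed

end
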